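(* Let $G$ be a connected graph (multi-edges and loops allowed). Then $G$ is a minimal $(2,2)$-dominated graph if and only if $G$ has the following three properties: (1) $\delta(G)\ge 2$; (2) $G$ is bipartite; (3) every edge of $G$ is incident with a vertex of degree $2$ in $G$.
   Context: Graphs may have multiple edges and multiple loops. The degree $d_G(v)$ is the number of edges incident with $v$ plus twice the number of loops at $v$; $\delta(G)$ is the minimum degree. A set $D\subseteq V(G)$ is a $2$-dominating set of $G$ if every vertex of $V(G)\setminus D$ is joined by at least two edges (counted with multiplicity) to a vertex or vertices of $D$. A pair $(D_1,D_2)$ of proper, disjoint subsets of $V(G)$ is a $(2,2)$-pair if both $D_1$ and $D_2$ are $2$-dominating sets of $G$; $G$ is a $(2,2)$-dominated graph if it has a $(2,2)$-pair. A connected graph $G$ is a minimal $(2,2)$-dominated graph if $G$ is $(2,2)$-dominated and no proper spanning subgraph of $G$ (i.e., no graph obtained from $G$ by deleting at least one edge) is $(2,2)$-dominated. *)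

theory Defs
  imports Main "HOL-Library.Uprod"
begin

text \<open>
  Undirected multigraphs: edges are named objects, so parallel edges are distinct edges with
  the same ends; the ends of an edge form an unordered pair, and a loop is an edge with ends
  \<open>Upair v v\<close>. Graphs are finite and have at least one vertex.
\<close>

record ('v, 'e) mgraph =
  verts :: "'v set"
  edges :: "'e set"
  ends :: "'e \<Rightarrow> 'v uprod"

locale multigraph =
  fixes G :: "('v, 'e) mgraph"
  assumes finite_verts: "finite (verts G)"
    and verts_nonempty: "verts G \<noteq> {}"
    and finite_edges: "finite (edges G)"
    and ends_in_verts: "e \<in> edges G \<Longrightarrow> set_uprod (ends G e) \<subseteq> verts G"

definition incident :: "('v, 'e) mgraph \<Rightarrow> 'e \<Rightarrow> 'v \<Rightarrow> bool" where
  "incident G e v \<longleftrightarrow> v \<in> set_uprod (ends G e)"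

text \<open>A loop contributes exactly 2 to the degree, hence the non-loops are counted separately.\<close>

definition degree :: "('v, 'e) mgraph \<Rightarrow> 'v \<Rightarrow> nat" where
  "degree G v =
     card {e \<in> edges G. incident G e v \<and> ends G e \<noteq> Upair v v}
     + 2 * card {e \<in> edges G. ends G e = Upair v v}"

definition min_degree :: "('v, 'e) mgraph \<Rightarrow> nat" where
  "min_degree G = Min (degree G ` verts G)"

definition adj :: "('v, 'e) mgraph \<Rightarrow> ('v \<times> 'v) set" where
  "adj G = {(u, v). \<exists>e \<in> edges G. ends G e = Upair u v}"

definition connected_graph :: "('v, 'e) mgraph \<Rightarrow> bool" where
  "connected_graph G \<longleftrightarrow> (\<forall>u \<in> verts G. \<forall>v \<in> verts G. (u, v) \<in> (adj G)\<^sup>*)"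

definition bipartite :: "('v, 'e) mgraph \<Rightarrow> bool" where
  "bipartite G \<longleftrightarrow>
     (\<exists>A B. A \<union> B = verts G \<and> A \<inter> B = {} \<and>
        (\<forall>e \<in> edges G. \<exists>a \<in> A. \<exists>b \<in> B. ends G e = Upair a b))"

definition two_dominating :: "('v, 'e) mgraph \<Rightarrow> 'v set \<Rightarrow> bool" where
  "two_dominating G D \<longleftrightarrow>
     D \<subseteq> verts G \<and>
     (\<forall>v \<in> verts G - D. card {e \<in> edges G. \<exists>u \<in> D. ends G e = Upair u v} \<ge> 2)"

definition two_two_pair :: "('v, 'e) mgraph \<Rightarrow> 'v set \<Rightarrow> 'v set \<Rightarrow> bool" where
  "two_two_pair G D1 D2 \<longleftrightarrow>
     D1 \<subset> verts G \<and> D2 \<subset> verts G \<and> D1 \<inter> D2 = {} \<and>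
     two_dominating G D1 \<and> two_dominating G D2"

definition two_two_dominated :: "('v, 'e) mgraph \<Rightarrow> bool" where
  "two_two_dominated G \<longleftrightarrow> (\<exists>D1 D2. two_two_pair G D1 D2)"

definition proper_spanning_subgraph :: "('v, 'e) mgraph \<Rightarrow> ('v, 'e) mgraph \<Rightarrow> bool" where
  "proper_spanning_subgraph H G \<longleftrightarrow>
     verts H = verts G \<and> edges H \<subset> edges G \<and> (\<forall>e \<in> edges H. ends H e = ends G e)"

definition minimal_two_two_dominated :: "('v, 'e) mgraph \<Rightarrow> bool" where
  "minimal_two_two_dominated G \<longleftrightarrow>
     connected_graph G \<and> two_two_dominated G \<and>
     (\<forall>H. proper_spanning_subgraph H G \<longrightarrow> \<not> two_two_dominated H)"

end

theory Submission
  imports Defs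
begin

text \<open>
  A \<open>(2,2)\<close>-pair \<open>(D\<^sub>1, D\<^sub>2)\<close> can be enlarged to the pair \<open>(V - D\<^sub>2, D\<^sub>2)\<close>, which uses only
  the edges between its two members. Hence a minimal graph is bipartite, and a bipartition of a
  graph is a \<open>(2,2)\<close>-pair exactly when all degrees are at least 2. An edge can therefore be
  dispensed with as soon as both of its ends have degree at least 3; conversely, every
  \<open>(2,2)\<close>-dominated graph has minimum degree at least 2, so an edge at a vertex of degree 2
  cannot be deleted.
\<close>

text \<open>Names the two sides that \<open>bipartite\<close> hides under quantifiers, since the
  sides themselves are to serve as the pair. Either side may be empty.\<close>

definition bipartition :: "('v, 'e) mgraph \<Rightarrow> 'v set \<Rightarrow> 'v set \<Rightarrow> bool" where
  "bipartition G A B \<longleftrightarrow> A \<union> B = verts G \<and> A \<inter> B = {} \<and>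
     (\<forall>e \<in> edges G. \<exists>a \<in> A. \<exists>b \<in> B. ends G e = Upair a b)"

lemma bipartite_iff_bipartition: "bipartite G \<longleftrightarrow> (\<exists>A B. bipartition G A B)"
  by (simp add: bipartite_def bipartition_def)

lemma bipartition_commute: "bipartition G A B \<Longrightarrow> bipartition G B A"
  unfolding bipartition_def by (metis Int_commute Un_commute Upair_inject)

lemma bipartition_no_loop:
  "bipartition G A B \<Longrightarrow> e \<in> edges G \<Longrightarrow> ends G e \<noteq> Upair v v"
  unfolding bipartition_def by (metis Upair_inject disjoint_iff)

lemma multigraph_edges_subset:
  assumes "multigraph G" "F \<subseteq> edges G"
  shows "multigraph (G\<lparr>edges := F\<rparr>)"
  using assms by (auto simp: multigraph_def intro: finite_subset)

text \<open>Stated apart from \<open>multigraph_edges_subset\<close> because \<open>ends H\<close>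
  may differ from \<open>ends G\<close> off \<open>edges H\<close>, so \<open>H\<close> need not be
  a record update of \<open>G\<close>.\<close>

lemma multigraph_proper_spanning_subgraph:
  assumes "multigraph G" "proper_spanning_subgraph H G"
  shows "multigraph H"
  using assms unfolding multigraph_def proper_spanning_subgraph_def
  by (metis finite_subset psubset_imp_subset subsetD)

lemma proper_spanning_subgraph_edges:
  "F \<subset> edges G \<Longrightarrow> proper_spanning_subgraph (G\<lparr>edges := F\<rparr>) G"
  by (simp add: proper_spanning_subgraph_def)

context
  fixes G :: "('v, 'e) mgraph"
  assumes G: "multigraph G"
begin

interpretation multigraph G by (rule G)

lemma min_degree_ge_iff: "min_degree G \<ge> k \<longleftrightarrow> (\<forall>v \<in> verts G. degree G v \<ge> k)"
  by (simp add: min_degree_def finite_verts verts_nonempty)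

text \<open>As \<open>v\<close> lies outside \<open>D\<close>, an edge from \<open>D\<close> to
  \<open>v\<close> is not a loop, so it is among the edges that the degree counts once.\<close>

lemma edges_into_le_degree:
  assumes "v \<notin> D"
  shows "card {e \<in> edges G. \<exists>u \<in> D. ends G e = Upair u v} \<le> degree G v"
proof -
  have "{e \<in> edges G. \<exists>u \<in> D. ends G e = Upair u v}
      \<subseteq> {e \<in> edges G. incident G e v \<and> ends G e \<noteq> Upair v v}"
    using assms by (auto simp: incident_def)
  then have "card {e \<in> edges G. \<exists>u \<in> D. ends G e = Upair u v}
      \<le> card {e \<in> edges G. incident G e v \<and> ends G e \<noteq> Upair v v}"
    by (intro card_mono) (simp_all add: finite_edges)
  then show ?thesis
    by (simp add: degree_def)
qed

text \<open>The members of a pair are disjoint, so \<open>v\<close> lies outside one of them, and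
  that one sends two edges to \<open>v\<close>.\<close>

lemma two_two_dominated_degree:
  assumes "two_two_dominated G" "v \<in> verts G"
  shows "degree G v \<ge> 2"
proof -
  obtain D where "two_dominating G D" "v \<notin> D"
    using assms unfolding two_two_dominated_def two_two_pair_def by blast
  then have "2 \<le> card {e \<in> edges G. \<exists>u \<in> D. ends G e = Upair u v}"
    using assms(2) by (simp add: two_dominating_def)
  then show ?thesis
    using edges_into_le_degree[OF \<open>v \<notin> D\<close>] by linarith
qed

text \<open>There are no loops, and every edge at a vertex of \<open>A\<close> comes from
  \<open>B\<close>, so the bound of \<open>edges_into_le_degree\<close> is attained for
  \<open>D = B\<close>.\<close>

lemma degree_bipartition:
  assumes "bipartition G A B" "v \<in> A"
  shows "degree G v = card {e \<in> edges G. \<exists>u \<in> B. ends G e = Upair u v}"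
proof -
  have "{e \<in> edges G. ends G e = Upair v v} = {}"
    using bipartition_no_loop[OF assms(1)] by blast
  moreover have "{e \<in> edges G. incident G e v \<and> ends G e \<noteq> Upair v v}
      = {e \<in> edges G. \<exists>u \<in> B. ends G e = Upair u v}"
    using assms unfolding bipartition_def incident_def
    by (fastforce simp: disjoint_iff)
  ultimately show ?thesis
    by (simp only: degree_def card.empty mult_0_right add_0_right)
qed

lemma two_dominating_bipartition:
  assumes "bipartition G A B" "\<And>v. v \<in> verts G \<Longrightarrow> degree G v \<ge> 2"
  shows "two_dominating G B"
  unfolding two_dominating_def
proof (intro conjI ballI)
  show "B \<subseteq> verts G"
    using assms(1) by (auto simp: bipartition_def)
next
  fix v assume v: "v \<in> verts G - B"
  then have "v \<in> A"
    using assms(1) by (auto simp: bipartition_def)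
  with v show "2 \<le> card {e \<in> edges G. \<exists>u \<in> B. ends G e = Upair u v}"
    using assms(2)[of v] degree_bipartition[OF assms(1)] by simp
qed

lemma two_two_pair_bipartition:
  assumes "bipartition G A B" "\<And>v. v \<in> verts G \<Longrightarrow> degree G v \<ge> 2"
  shows "two_two_pair G A B"
proof -
  \<comment> \<open>An edge has an end on each side, so both sides are nonempty; by disjointness
    both are then proper subsets, as a pair requires.\<close>
  have "edges G \<noteq> {}"
  proof
    assume "edges G = {}"
    then have "degree G v = 0" for v
      by (simp add: degree_def)
    with assms(2) verts_nonempty show False
      by fastforce
  qed
  then have "A \<noteq> {}" "B \<noteq> {}"
    using assms(1) by (auto simp: bipartition_def)
  then have "A \<subset> verts G" "B \<subset> verts G" "A \<inter> B = {}"
    using assms(1) by (auto simp: bipartition_def)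
  then show ?thesis
    using two_dominating_bipartition assms bipartition_commute[OF assms(1)]
    unfolding two_two_pair_def by blast
qed

text \<open>Neither the non-loops nor the loops at \<open>v\<close> can increase in
  \<open>H\<close>, and the lost edge \<open>e\<close> belongs to one of these two sets in
  \<open>G\<close>, which makes that inclusion strict.\<close>

lemma degree_proper_spanning_subgraph_less:
  assumes H: "proper_spanning_subgraph H G"
    and e: "e \<in> edges G" "e \<notin> edges H" "incident G e v"
  shows "degree H v < degree G v"
proof -
  let ?N = "\<lambda>K :: ('v, 'e) mgraph. {e \<in> edges K. incident K e v \<and> ends K e \<noteq> Upair v v}"
  let ?L = "\<lambda>K :: ('v, 'e) mgraph. {e \<in> edges K. ends K e = Upair v v}"
  have N: "?N H \<subseteq> ?N G" and L: "?L H \<subseteq> ?L G"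
    using H by (auto simp: proper_spanning_subgraph_def incident_def)
  have fin: "finite (?N G)" "finite (?L G)"
    by (simp_all add: finite_edges)
  have "?N H \<subset> ?N G \<or> ?L H \<subset> ?L G"
    using N L e by blast
  then show ?thesis
    using card_mono[OF fin(1) N] card_mono[OF fin(2) L]
      psubset_card_mono[OF fin(1), of "?N H"] psubset_card_mono[OF fin(2), of "?L H"]
    unfolding degree_def by fastforce
qed

text \<open>The hypothesis excludes a loop at \<open>v\<close>, whose deletion would cost 2.\<close>

lemma degree_le_Suc_delete_edge:
  assumes "ends G e \<noteq> Upair v v"
  shows "degree G v \<le> Suc (degree (G\<lparr>edges := edges G - {e}\<rparr>) v)"
proof -
  let ?N = "{e \<in> edges G. incident G e v \<and> ends G e \<noteq> Upair v v}"
  have N: "{f \<in> edges G - {e}. incident G f v \<and> ends G f \<noteq> Upair v v} = ?N - {e}"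
    by auto
  have L: "{f \<in> edges G - {e}. ends G f = Upair v v} = {f \<in> edges G. ends G f = Upair v v}"
    using assms by auto
  have "card ?N \<le> Suc (card (?N - {e}))"
    unfolding card_Diff_singleton_if by simp linarith
  then show ?thesis
    unfolding degree_def using N L by (simp add: incident_def)
qed

lemma degree_delete_edge_not_incident:
  assumes "\<not> incident G e v"
  shows "degree (G\<lparr>edges := edges G - {e}\<rparr>) v = degree G v"
proof -
  have "{f \<in> edges G - {e}. incident G f v \<and> ends G f \<noteq> Upair v v}
      = {f \<in> edges G. incident G f v \<and> ends G f \<noteq> Upair v v}"
    and "{f \<in> edges G - {e}. ends G f = Upair v v} = {f \<in> edges G. ends G f = Upair v v}"
    using assms by (auto simp: incident_def)
  then show ?thesis
    by (simp add: degree_def incident_def)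
qed

text \<open>The enlarged pair still dominates in the subgraph \<open>?H\<close> that keeps only the
  edges between its members, so minimality forces \<open>?H\<close> to have all edges of
  \<open>G\<close>.\<close>

lemma minimal_two_two_dominated_bipartition:
  assumes min: "minimal_two_two_dominated G" and pair: "two_two_pair G D1 D2"
  shows "bipartition G (verts G - D2) D2"
proof -
  let ?A = "verts G - D2"
  define F where "F = {e \<in> edges G. \<exists>a \<in> ?A. \<exists>b \<in> D2. ends G e = Upair a b}"
  let ?H = "G\<lparr>edges := F\<rparr>"
  have D: "D1 \<subset> verts G" "D2 \<subset> verts G" "D1 \<inter> D2 = {}"
    "two_dominating G D1" "two_dominating G D2"
    using pair by (auto simp: two_two_pair_def)
  have "finite F"
    unfolding F_def by (simp add: finite_edges)
  have dom1: "two_dominating ?H ?A"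
    unfolding two_dominating_def
  proof (intro conjI ballI)
    fix v assume "v \<in> verts ?H - ?A"
    then have v: "v \<in> D2" "v \<in> verts G - D1"
      using D by auto
    have "2 \<le> card {e \<in> edges G. \<exists>u \<in> D1. ends G e = Upair u v}"
      using D v by (simp add: two_dominating_def)
    \<comment> \<open>Edges from \<open>D1\<close> to \<open>v\<close> survive in \<open>F\<close>,
      because \<open>D1\<close> is contained in \<open>?A\<close> and \<open>v\<close> is in
      \<open>D2\<close>.\<close>
    also have "\<dots> \<le> card {e \<in> F. \<exists>u \<in> ?A. ends G e = Upair u v}"
    proof (intro card_mono subsetI)
      fix e assume "e \<in> {e \<in> edges G. \<exists>u \<in> D1. ends G e = Upair u v}"
      then obtain u where u: "e \<in> edges G" "u \<in> D1" "ends G e = Upair u v"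
        by blast
      then have "u \<in> ?A"
        using D by blast
      with u v show "e \<in> {e \<in> F. \<exists>u \<in> ?A. ends G e = Upair u v}"
        unfolding F_def by blast
    qed (simp add: \<open>finite F\<close>)
    finally show "2 \<le> card {e \<in> edges ?H. \<exists>u \<in> ?A. ends ?H e = Upair u v}"
      by simp
  qed simp
  have dom2: "two_dominating ?H D2"
    unfolding two_dominating_def
  proof (intro conjI ballI)
    fix v assume "v \<in> verts ?H - D2"
    then have v: "v \<in> verts G - D2"
      by simp
    have "2 \<le> card {e \<in> edges G. \<exists>u \<in> D2. ends G e = Upair u v}"
      using D v by (simp add: two_dominating_def)
    \<comment> \<open>Here \<open>v\<close> is in \<open>?A\<close>, so every edge from
      \<open>D2\<close> to \<open>v\<close> is already in \<open>F\<close>.\<close>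
    also have "{e \<in> edges G. \<exists>u \<in> D2. ends G e = Upair u v}
        = {e \<in> F. \<exists>u \<in> D2. ends G e = Upair u v}"
      using v unfolding F_def by auto blast
    finally show "2 \<le> card {e \<in> edges ?H. \<exists>u \<in> D2. ends ?H e = Upair u v}"
      by simp
  qed (use D in simp)
  \<comment> \<open>This makes \<open>?A\<close> a proper subset of the vertices; the empty set
    sends no edges and dominates no vertex.\<close>
  have "D2 \<noteq> {}"
    using D(5) verts_nonempty by (auto simp: two_dominating_def)
  then have "two_two_pair ?H ?A D2"
    using dom1 dom2 D unfolding two_two_pair_def by auto
  then have "\<not> proper_spanning_subgraph ?H G"
    using min unfolding minimal_two_two_dominated_def two_two_dominated_def by blast
  then have "\<not> F \<subset> edges G"
    using proper_spanning_subgraph_edges[of F G] by blast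
  moreover have "F \<subseteq> edges G"
    unfolding F_def by blast
  ultimately have "F = edges G"
    by blast
  then show ?thesis
    using \<open>D2 \<subset> verts G\<close> unfolding bipartition_def F_def by blast
qed

end

lemma minimal_two_two_dominated_degree_two:
  assumes G: "multigraph G" and min: "minimal_two_two_dominated G"
    and bip: "bipartition G A B" and e: "e \<in> edges G"
  shows "\<exists>v \<in> verts G. incident G e v \<and> degree G v = 2"
proof (rule ccontr)
  assume contra: "\<not> ?thesis"
  let ?H = "G\<lparr>edges := edges G - {e}\<rparr>"
  have deg: "degree G v \<ge> 2" if "v \<in> verts G" for v
    using two_two_dominated_degree[OF G] min that unfolding minimal_two_two_dominated_def by blast
  have degH: "degree ?H v \<ge> 2" if "v \<in> verts ?H" for v
  proof (cases "incident G e v")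
    case True
    then have "degree G v \<noteq> 2"
      using contra that by auto
    \<comment> \<open>The degree of \<open>v\<close> in \<open>G\<close> is at least 3, and
      \<open>e\<close> is not a loop, so at least 2 remains.\<close>
    with deg[of v] degree_le_Suc_delete_edge[OF G bipartition_no_loop[OF bip e], of v] that
    show ?thesis
      by simp
  next
    case False
    then show ?thesis
      using deg that by (simp add: degree_delete_edge_not_incident[OF G])
  qed
  have "bipartition ?H A B"
    using bip by (auto simp: bipartition_def)
  then have "two_two_pair ?H A B"
    by (rule two_two_pair_bipartition[OF multigraph_edges_subset[OF G Diff_subset] _ degH])
  moreover have "proper_spanning_subgraph ?H G"
    using e by (intro proper_spanning_subgraph_edges) blast
  ultimately show False
    using min unfolding minimal_two_two_dominated_def two_two_dominated_def by blast
qed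

theorem theorem2p5:
  fixes G :: "('v, 'e) mgraph"
  assumes "multigraph G" and "connected_graph G"
  shows "minimal_two_two_dominated G \<longleftrightarrow>
    min_degree G \<ge> 2 \<and>
    bipartite G \<and>
    (\<forall>e \<in> edges G. \<exists>v \<in> verts G. incident G e v \<and> degree G v = 2)"
proof
  assume min: "minimal_two_two_dominated G"
  then have dom: "two_two_dominated G"
    by (simp add: minimal_two_two_dominated_def)
  then obtain A B where bip: "bipartition G A B"
    using minimal_two_two_dominated_bipartition[OF assms(1) min]
    unfolding two_two_dominated_def by blast
  show "min_degree G \<ge> 2 \<and> bipartite G \<and>
    (\<forall>e \<in> edges G. \<exists>v \<in> verts G. incident G e v \<and> degree G v = 2)"
    using bip min_degree_ge_iff[OF assms(1)] two_two_dominated_degree[OF assms(1) dom]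
      minimal_two_two_dominated_degree_two[OF assms(1) min bip]
    unfolding bipartite_iff_bipartition by blast
next
  assume R: "min_degree G \<ge> 2 \<and> bipartite G \<and>
    (\<forall>e \<in> edges G. \<exists>v \<in> verts G. incident G e v \<and> degree G v = 2)"
  have deg: "\<And>v. v \<in> verts G \<Longrightarrow> degree G v \<ge> 2"
    using R min_degree_ge_iff[OF assms(1)] by blast
  obtain A B where "bipartition G A B"
    using R by (auto simp: bipartite_iff_bipartition)
  then have "two_two_dominated G"
    using two_two_pair_bipartition[OF assms(1)] deg unfolding two_two_dominated_def by blast
  moreover have "\<not> two_two_dominated H" if H: "proper_spanning_subgraph H G" for H
  proof
    assume domH: "two_two_dominated H"
    \<comment> \<open>\<open>H\<close> may lack many edges; one missing edge \<open>e\<close>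
      suffices, since its end of degree 2 in \<open>G\<close> has degree below 2 in
      \<open>H\<close>.\<close>
    obtain e where e: "e \<in> edges G" "e \<notin> edges H"
      using H by (auto simp: proper_spanning_subgraph_def)
    then obtain v where v: "v \<in> verts G" "incident G e v" "degree G v = 2"
      using R by blast
    then have "degree H v < 2"
      using degree_proper_spanning_subgraph_less[OF assms(1) H e v(2)] v(3) by simp
    moreover have "v \<in> verts H"
      using H v by (simp add: proper_spanning_subgraph_def)
    ultimately show False
      using two_two_dominated_degree[OF multigraph_proper_spanning_subgraph[OF assms(1) H] domH]
      by fastforce
  qed
  ultimately show "minimal_two_two_dominated G"
    using assms(2) by (simp add: minimal_two_two_dominated_def)
qed

end
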